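(* Let $\alpha_1,\dots,\alpha_K\in\mathbb R^d$, $\omega_1,\dots,\omega_K>0$, and for $\eta\in\mathbb R^d$ let $f(\theta)=-\sum_{k=1}^K\omega_k\exp(\alpha_k^{T}\theta)+\eta^{T}\theta-\tfrac12\theta^{T}\theta$, with unique maximizer $\hat\theta$, and let $I(\theta)=I_d+\sum_{k=1}^K\omega_k\exp(\alpha_k^{T}\theta)\alpha_k\alpha_k^{T}$. Then there is a constant $M>0$ not depending on $\eta$ such that $M^{-1}\frac{\exp(f(\hat\theta))}{\sqrt{\det I(\hat\theta)}}\le\int_{\mathbb R^d}(2\pi)^{-d/2}\exp(f(\theta))\,d\theta\le M\frac{\exp(f(\hat\theta))}{\sqrt{\det I(\hat\theta)}}.$ *)

theory Defs
  imports "HOL-Analysis.Analysis"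
begin

text \<open>Log-density f(theta) = - sum_k w_k exp(a_k . theta) + eta . theta - theta . theta / 2,
  with K terms indexed by k < K.\<close>
definition logdens :: "nat \<Rightarrow> (nat \<Rightarrow> real^'n) \<Rightarrow> (nat \<Rightarrow> real) \<Rightarrow> real^'n \<Rightarrow> real^'n \<Rightarrow> real" where
  "logdens K \<alpha> \<omega> \<eta> \<theta> =
     - (\<Sum>k<K. \<omega> k * exp (\<alpha> k \<bullet> \<theta>)) + \<eta> \<bullet> \<theta> - (1/2) * (\<theta> \<bullet> \<theta>)"

text \<open>Outer product a a^T.\<close>
definition outer :: "real^'n \<Rightarrow> real^'n \<Rightarrow> real^'n^'n" where
  "outer a b = (\<chi> i j. a $ i * b $ j)"

text \<open>I(theta) = I_d + sum_k w_k exp(a_k . theta) a_k a_k^T.\<close>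
definition infomat :: "nat \<Rightarrow> (nat \<Rightarrow> real^'n) \<Rightarrow> (nat \<Rightarrow> real) \<Rightarrow> real^'n \<Rightarrow> real^'n^'n" where
  "infomat K \<alpha> \<omega> \<theta> =
     mat 1 + (\<Sum>k<K. (\<omega> k * exp (\<alpha> k \<bullet> \<theta>)) *\<^sub>R outer (\<alpha> k) (\<alpha> k))"

end

theory Submission
  imports Defs "HOL-Probability.Distributions" "HOL-Library.Cardinality"
begin

text \<open>At the mode \<open>\<theta>h\<close> the gradient of \<open>f\<close> vanishes, so
  \<open>f(\<theta>h + \<theta>) = f(\<theta>h) + g(\<theta>)\<close> with \<open>g(\<theta>) = - \<Sum>\<^sub>k c\<^sub>k \<phi>(\<alpha>\<^sub>k\<cdot>\<theta>) - |\<theta>|\<^sup>2/2\<close>,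
  \<open>c\<^sub>k = \<omega>\<^sub>k exp(\<alpha>\<^sub>k\<cdot>\<theta>h)\<close> and \<open>\<phi>(x) = e\<^sup>x - 1 - x\<close>. Factor \<open>I(\<theta>h) = R\<^sup>T R\<close>;
  then \<open>|R\<theta>|\<^sup>2 = \<theta>\<^sup>T I(\<theta>h) \<theta>\<close> and \<open>\<surd>det I(\<theta>h) = |det R|\<close>.
  Since \<open>\<phi>(x)\<close> is comparable to \<open>x\<^sup>2\<close> for \<open>|x| \<le> 1\<close> and \<open>\<phi>\<close> is convex, for a radius
  \<open>r\<close> depending only on the \<open>\<alpha>\<^sub>k\<close> the function \<open>g\<close> is bounded below by a constant where
  \<open>|R\<theta>| \<le> r\<close> and above by \<open>(r\<^sup>2 - r|R\<theta>|)/2e\<close> everywhere. After the substitution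
  \<open>u = R\<theta>\<close>, \<open>|det R| \<integral> e\<^sup>g\<close> is squeezed between two integrals that depend neither on
  \<open>\<eta>\<close> nor on the \<open>c\<^sub>k\<close>.\<close>

section \<open>Linear change of variables\<close>

text \<open>The change of variables theorems of \<open>Change_Of_Vars\<close> need an index type of class
  \<open>wellorder\<close>. The type \<open>'n fin\<close> is a wellordered copy of an arbitrary finite index type,
  through which they are transported.\<close>

typedef ('n::finite) fin = "{..<CARD('n)} :: nat set"
  by (rule exI[of _ 0]) simp

instantiation fin :: (finite) linorder
begin
definition less_eq_fin_def: "a \<le> b \<longleftrightarrow> Rep_fin a \<le> Rep_fin b"
definition less_fin_def: "a < b \<longleftrightarrow> Rep_fin a < Rep_fin b"
instance
  by standard (auto simp: less_eq_fin_def less_fin_def Rep_fin_inject)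
end

instance fin :: (finite) finite
  by standard (simp flip: type_definition.Abs_image[OF type_definition_fin])

instance fin :: (finite) wellorder
proof (rule wf_wellorderI)
  show "wf {(x :: 'a fin, y). x < y}"
    using wf_inv_image[OF wf_less, of Rep_fin] by (simp add: inv_image_def less_fin_def)
qed intro_classes

lemma bij_fin_exists: "\<exists>p :: 'n::finite fin \<Rightarrow> 'n. bij p"
proof -
  have "CARD('n fin) = CARD('n)"
    using type_definition.card[OF type_definition_fin] by simp
  then have "\<exists>p. bij_betw p (UNIV :: 'n fin set) (UNIV :: 'n set)"
    by (intro finite_same_card_bij) simp_all
  then show ?thesis by simp
qed

lemma det_reindex:
  fixes L :: "real^'n::finite^'n" and p :: "'m::finite \<Rightarrow> 'n"
  assumes p: "bij p"
  shows "det (\<chi> i j. L $ p i $ p j) = det L"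
proof -
  let ?M = "map_permutation (UNIV::'m set) p"
  let ?N = "map_permutation (UNIV::'n set) (inv p)"
  have bp: "bij_betw p UNIV UNIV" and bip: "bij_betw (inv p) UNIV UNIV"
    using p bij_imp_bij_inv[OF p] by (simp_all add: bij_betw_def bij_def)
  have inj: "inj p" using p bij_def by blast
  have app: "?M q (p i) = p (q i)" for q i
    using map_permutation_apply[OF inj] by simp
  have "det (\<chi> i j. L $ p i $ p j) = (\<Sum>q | q permutes (UNIV::'m set). of_int (sign q) * (\<Prod>i\<in>UNIV. L $ p i $ p (q i)))"
    unfolding det_def by simp
  also have "\<dots> = (\<Sum>q | q permutes (UNIV::'n set). of_int (sign q) * (\<Prod>i\<in>UNIV. L $ i $ q i))"
  proof (rule sum.reindex_bij_witness[where i = ?N and j = ?M])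
    fix q :: "'m \<Rightarrow> 'm" assume "q \<in> {q. q permutes UNIV}"
    then have q: "q permutes UNIV" by simp
    show "?M q \<in> {q. q permutes UNIV}" using map_permutation_permutes[OF bp q] by simp
    show "?N (?M q) = q"
      by (rule map_permutation_compose_inv[OF bp q]) (simp add: inv_f_f[OF inj])
    have "(\<Prod>i\<in>UNIV. L $ i $ ?M q i) = (\<Prod>i\<in>UNIV. L $ p i $ ?M q (p i))"
      by (rule prod.reindex_bij_betw[OF bp, symmetric])
    then show "of_int (sign (?M q)) * (\<Prod>i\<in>UNIV. L $ i $ ?M q i) =
        of_int (sign q) * (\<Prod>i\<in>UNIV. L $ p i $ p (q i))"
      using sign_map_permutation[OF inj q] by (simp add: app)
  next
    fix q :: "'n \<Rightarrow> 'n" assume "q \<in> {q. q permutes UNIV}"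
    then have q: "q permutes UNIV" by simp
    show "?N q \<in> {q. q permutes UNIV}" using map_permutation_permutes[OF bip q] by simp
    show "?M (?N q) = q"
      by (rule map_permutation_compose_inv[OF bip q]) (simp add: surj_f_inv_f[OF bij_is_surj[OF p]])
  qed
  also have "\<dots> = det L" unfolding det_def by simp
  finally show ?thesis .
qed

lemma prod_Basis_cart:
  "(\<Prod>b\<in>(Basis :: (real^'n::finite) set). f b) = (\<Prod>i\<in>UNIV. f (axis i 1))"
proof -
  have Basis: "(Basis :: (real^'n) set) = range (\<lambda>i. axis i 1)"
    by (auto simp: Basis_vec_def)
  have "inj (\<lambda>i::'n. axis i (1::real))"
    by (auto intro!: injI simp: axis_eq_axis)
  then show ?thesis unfolding Basis by (simp add: prod.reindex)
qed

lemma emeasure_lborel_box_cart: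
  fixes l u :: "real^'n::finite"
  assumes "\<And>i. l $ i \<le> u $ i"
  shows "emeasure lborel (box l u) = (\<Prod>i\<in>UNIV. u $ i - l $ i)"
proof -
  have "\<And>b. b \<in> Basis \<Longrightarrow> l \<bullet> b \<le> u \<bullet> b"
    using assms by (auto simp: Basis_vec_def inner_axis)
  then show ?thesis
    by (simp add: prod_Basis_cart inner_axis)
qed

definition reindex_vec :: "('m \<Rightarrow> 'n) \<Rightarrow> 'a^'n \<Rightarrow> 'a^'m" where
  "reindex_vec p x = (\<chi> j. x $ p j)"

lemma reindex_vec_measurable[measurable]:
  "(reindex_vec p :: real^'n::finite \<Rightarrow> real^'m::finite) \<in> borel_measurable borel"
proof -
  have "linear (reindex_vec p :: real^'n \<Rightarrow> real^'m)"
    by (rule linearI) (simp_all add: reindex_vec_def vec_eq_iff)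
  then show ?thesis
    by (intro borel_measurable_continuous_onI linear_continuous_on)
       (simp add: linear_conv_bounded_linear[symmetric])
qed

lemma lborel_reindex_vec:
  fixes p :: "'m::finite \<Rightarrow> 'n::finite"
  assumes p: "bij p"
  shows "distr lborel borel (reindex_vec p :: real^'n \<Rightarrow> real^'m) = lborel"
proof (rule lborel_eqI[symmetric])
  fix l u :: "real^'m"
  assume "\<And>b. b \<in> Basis \<Longrightarrow> l \<bullet> b \<le> u \<bullet> b"
  then have le: "l $ i \<le> u $ i" for i by (force simp: inner_axis Basis_vec_def)
  define l' u' where "l' = (\<chi> j. l $ inv p j)" and "u' = (\<chi> j. u $ inv p j)"
  have "x \<in> reindex_vec p -` box l u \<longleftrightarrow> x \<in> box l' u'" for x
  proof -
    have "x \<in> reindex_vec p -` box l u \<longleftrightarrow> (\<forall>j. l $ j < x $ p j \<and> x $ p j < u $ j)"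
      by (simp add: mem_box_cart reindex_vec_def)
    also have "\<dots> \<longleftrightarrow> (\<forall>i. l $ inv p i < x $ i \<and> x $ i < u $ inv p i)"
      by (metis p bij_inv_eq_iff)
    finally show ?thesis by (simp add: mem_box_cart l'_def u'_def)
  qed
  then have "reindex_vec p -` box l u = box l' u'" by blast
  then have "emeasure (distr lborel borel (reindex_vec p)) (box l u) = emeasure lborel (box l' u')"
    by (simp add: emeasure_distr)
  also have "\<dots> = (\<Prod>i\<in>UNIV. u $ inv p i - l $ inv p i)"
    by (subst emeasure_lborel_box_cart) (simp_all add: l'_def u'_def le)
  also have "\<dots> = (\<Prod>j\<in>UNIV. u $ j - l $ j)"
    using prod.reindex_bij_betw[of "inv p" UNIV UNIV "\<lambda>j. u $ j - l $ j"] bij_imp_bij_inv[OF p]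
    by (simp add: bij_betw_def bij_def)
  also have "\<dots> = (\<Prod>b\<in>Basis. (u - l) \<bullet> b)"
    by (simp add: prod_Basis_cart inner_axis)
  finally show "emeasure (distr lborel borel (reindex_vec p)) (box l u) = (\<Prod>b\<in>Basis. (u - l) \<bullet> b)" .
qed simp

lemma matrix_vector_mult_measurable[measurable]:
  "((*v) (L::real^'n::finite^'m::finite)) \<in> borel_measurable borel"
  by (intro borel_measurable_continuous_onI linear_continuous_on)
     (simp add: linear_conv_bounded_linear[symmetric])

lemma lborel_matrix_density_wellorder:
  fixes L :: "real^('n::{finite,wellorder})^('n::{finite,wellorder})"
  assumes "invertible L"
  shows "lborel = density (distr lborel borel ((*v) L)) (\<lambda>_. ennreal \<bar>det L\<bar>)"
proof (rule lborel_eqI)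
  obtain Li where Li: "L ** Li = mat 1" "Li ** L = mat 1"
    using assms unfolding invertible_def by blast
  have det_inv: "\<bar>det L\<bar> * \<bar>det Li\<bar> = 1"
    using Li(1) by (metis abs_1 abs_mult det_I det_mul)
  fix l u :: "real^('n::{finite,wellorder})"
  assume le: "\<And>b. b \<in> Basis \<Longrightarrow> l \<bullet> b \<le> u \<bullet> b"
  have pre: "(*v) L -` box l u = (*v) Li ` box l u"
    using Li by (auto simp: image_iff matrix_vector_mul_assoc) (metis matrix_vector_mul_assoc matrix_vector_mul_lid)
  have lin: "linear ((*v) Li)" by simp
  have bl: "box l u \<in> lmeasurable" by simp
  have "(*v) Li ` box l u \<in> sets borel"
    unfolding pre[symmetric] using measurable_sets_borel[of "(*v) L" borel] by simp
  then have "emeasure lborel ((*v) Li ` box l u) = emeasure lebesgue ((*v) Li ` box l u)"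
    by simp
  also have "\<dots> = ennreal (\<bar>det Li\<bar> * measure lebesgue (box l u))"
    using measurable_linear_image[OF lin bl] measure_linear_image[OF lin bl]
    by (simp add: emeasure_eq_measure2)
  finally have image_measure: "emeasure lborel ((*v) Li ` box l u) = \<dots>" .
  have "emeasure (density (distr lborel borel ((*v) L)) (\<lambda>_. ennreal \<bar>det L\<bar>)) (box l u)
        = ennreal (\<bar>det L\<bar> * (\<bar>det Li\<bar> * measure lebesgue (box l u)))"
    by (simp add: emeasure_density_const emeasure_distr pre image_measure ennreal_mult)
  also have "\<dots> = emeasure lborel (box l u)"
    using bl det_inv by (simp add: emeasure_eq_measure2 mult.assoc[symmetric])
  also have "\<dots> = (\<Prod>b\<in>Basis. (u - l) \<bullet> b)"
    using le by (rule emeasure_lborel_box)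
  finally show "emeasure (density (distr lborel borel ((*v) L)) (\<lambda>_. ennreal \<bar>det L\<bar>)) (box l u)
      = (\<Prod>b\<in>Basis. (u - l) \<bullet> b)" .
qed simp

lemma matrix_vector_mult_reindex_vec:
  fixes L :: "real^'n::finite^'n" and p :: "'m::finite \<Rightarrow> 'n"
  assumes p: "bij p"
  shows "L *v reindex_vec (inv p) y = reindex_vec (inv p) ((\<chi> i j. L $ p i $ p j) *v y)"
proof -
  have "(reindex_vec (inv p) ((\<chi> i j. L $ p i $ p j) *v y)) $ j = (\<Sum>i\<in>UNIV. L $ j $ p i * y $ i)" for j
    by (simp add: reindex_vec_def matrix_vector_mult_def surj_f_inv_f[OF bij_is_surj[OF p]])
  moreover have "(\<Sum>i\<in>UNIV. L $ j $ p i * y $ i) = (L *v reindex_vec (inv p) y) $ j" for j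
    using sum.reindex_bij_betw[of p UNIV UNIV "\<lambda>k. L $ j $ k * y $ inv p k"] p
    by (simp add: bij_betw_def bij_def inv_f_f reindex_vec_def matrix_vector_mult_def)
  ultimately show ?thesis by (simp add: vec_eq_iff)
qed

lemma lborel_matrix_density:
  fixes L :: "real^'n::finite^'n"
  assumes L: "invertible L"
  shows "lborel = density (distr lborel borel ((*v) L)) (\<lambda>_. ennreal \<bar>det L\<bar>)"
proof -
  obtain p :: "'n fin \<Rightarrow> 'n" where p: "bij p" using bij_fin_exists by blast
  define L' where "L' = (\<chi> i j. L $ p i $ p j)"
  define T where "T = (reindex_vec (inv p) :: real^'n fin \<Rightarrow> real^'n)"
  have det: "det L' = det L" unfolding L'_def by (rule det_reindex[OF p])
  then have "invertible L'" using L by (simp add: invertible_det_nz)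
  then have L'_density: "density (distr lborel borel ((*v) L')) (\<lambda>_. ennreal \<bar>det L\<bar>) = lborel"
    unfolding det[symmetric] by (rule lborel_matrix_density_wellorder[symmetric])
  have comm: "(*v) L \<circ> T = T \<circ> (*v) L'"
    using matrix_vector_mult_reindex_vec[OF p] by (auto simp: T_def L'_def)
  have T_lborel: "distr lborel borel T = lborel"
    unfolding T_def by (rule lborel_reindex_vec[OF bij_imp_bij_inv[OF p]])
  have [measurable]: "T \<in> borel_measurable borel" unfolding T_def by simp
  have "density (distr lborel borel ((*v) L)) (\<lambda>_. ennreal \<bar>det L\<bar>)
      = density (distr (distr lborel borel T) borel ((*v) L)) (\<lambda>_. ennreal \<bar>det L\<bar>)"
    by (simp add: T_lborel)
  also have "\<dots> = density (distr (distr lborel borel ((*v) L')) borel T) (\<lambda>_. ennreal \<bar>det L\<bar>)"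
    by (simp add: distr_distr comm)
  also have "\<dots> = distr (density (distr lborel borel ((*v) L')) (\<lambda>_. ennreal \<bar>det L\<bar>)) borel T"
    by (subst density_distr) (auto cong: distr_cong)
  also have "\<dots> = lborel" by (simp add: L'_density T_lborel)
  finally show ?thesis ..
qed

lemma nn_integral_matrix_substitution:
  fixes L :: "real^'n::finite^'n" and F :: "real^'n \<Rightarrow> ennreal"
  assumes L: "invertible L" and [measurable]: "F \<in> borel_measurable borel"
  shows "(\<integral>\<^sup>+x. F x \<partial>lborel) = ennreal \<bar>det L\<bar> * (\<integral>\<^sup>+x. F (L *v x) \<partial>lborel)"
proof -
  have "(\<integral>\<^sup>+x. F x \<partial>lborel) = (\<integral>\<^sup>+x. F x \<partial>density (distr lborel borel ((*v) L)) (\<lambda>_. ennreal \<bar>det L\<bar>))"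
    using lborel_matrix_density[OF L] by simp
  also have "\<dots> = (\<integral>\<^sup>+x. ennreal \<bar>det L\<bar> * F (L *v x) \<partial>lborel)"
    by (simp add: nn_integral_density nn_integral_distr)
  finally show ?thesis by (simp add: nn_integral_cmult)
qed

section \<open>Gram factorisation of the information matrix\<close>

lemma outer_mult: "(outer u v :: real^'n::finite^'n) ** outer x y = (v \<bullet> x) *\<^sub>R outer u y"
  unfolding outer_def matrix_matrix_mult_def vec_eq_iff inner_vec_def
  by (auto simp: sum_distrib_left sum_distrib_right mult_ac)

lemma matrix_vector_mult_outer: "(outer u v :: real^'n::finite^'n) *v x = (v \<bullet> x) *\<^sub>R u"
  by (simp add: outer_def matrix_vector_mult_def vec_eq_iff inner_vec_def sum_distrib_left mult_ac)

lemma transpose_mult_outer_mult: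
  "transpose M ** (outer u v :: real^'n::finite^'n) ** N = outer (transpose M *v u) (transpose N *v v)"
proof -
  have "(transpose M ** outer u v ** N) $ i $ j = (\<Sum>l\<in>UNIV. (\<Sum>k\<in>UNIV. M $ k $ i * u $ k * v $ l) * N $ l $ j)" for i j
    unfolding matrix_matrix_mult_def outer_def transpose_def by (simp add: mult.assoc)
  also have "\<dots> i j = (\<Sum>k\<in>UNIV. M $ k $ i * u $ k) * (\<Sum>l\<in>UNIV. N $ l $ j * v $ l)" for i j
    by (simp add: sum_distrib_left sum_distrib_right mult_ac)
  finally show ?thesis
    by (simp add: vec_eq_iff outer_def matrix_vector_mult_def transpose_def)
qed

lemma matrix_add_rdistrib: "(B + C) ** A = B ** A + C ** (A::real^'n::finite^'n)"
  by (vector matrix_matrix_mult_def sum.distrib[symmetric] field_simps)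

lemma matrix_vector_mult_sum: "(\<Sum>k<(K::nat). A k :: real^'n::finite^'m::finite) *v x = (\<Sum>k<K. A k *v x)"
  by (induction K) (simp_all add: matrix_vector_mult_add_rdistrib)

lemma identity_plus_outer_mult:
  "(mat 1 + x *\<^sub>R outer b b :: real^'n::finite^'n) ** (mat 1 + y *\<^sub>R outer b b)
   = mat 1 + (x + y + x * y * (b \<bullet> b)) *\<^sub>R outer b b"
  by (simp add: matrix_add_ldistrib matrix_add_rdistrib matrix_scalar_ac scalar_matrix_assoc[symmetric]
      outer_mult algebra_simps)

text \<open>With \<open>b = R\<^sup>-\<^sup>T a\<close> we have \<open>R\<^sup>T R + c a a\<^sup>T = R\<^sup>T (I + c b b\<^sup>T) R\<close>, and
  \<open>I + c b b\<^sup>T = S\<^sup>2\<close> for the symmetric \<open>S = I + \<beta> b b\<^sup>T\<close> with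
  \<open>\<beta> = (\<surd>(1 + c |b|\<^sup>2) - 1) / |b|\<^sup>2\<close>.\<close>

lemma gram_add_outer:
  fixes R :: "real^'n::finite^'n" and a :: "real^'n"
  assumes R: "invertible R" and c: "c \<ge> 0"
  obtains R' :: "real^'n^'n"
  where "invertible R'" "transpose R' ** R' = transpose R ** R + c *\<^sub>R outer a a"
proof -
  obtain Ri where Ri: "R ** Ri = mat 1" "Ri ** R = mat 1"
    using R unfolding invertible_def by blast
  define b where "b = transpose Ri *v a"
  have Rb: "transpose R *v b = a"
    unfolding b_def matrix_vector_mul_assoc matrix_transpose_mul[symmetric] Ri by simp
  show ?thesis
  proof (cases "b = 0")
    case True
    then have "a = 0" using Rb by simp
    then have "outer a a = (0::real^'n^'n)" by (simp add: outer_def vec_eq_iff)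
    then show ?thesis using R by (intro that[of R]) simp_all
  next
    case False
    define n2 where "n2 = b \<bullet> b"
    have n2: "n2 > 0" using False unfolding n2_def by simp
    define s where "s = sqrt (1 + c * n2)"
    have s1: "s \<ge> 1" and ss: "s * s = 1 + c * n2" unfolding s_def using c n2 by simp_all
    define \<beta> where "\<beta> = (s - 1) / n2"
    define \<gamma> where "\<gamma> = \<beta> / s"
    define S where "S = mat 1 + \<beta> *\<^sub>R outer b b"
    have \<beta>n2: "\<beta> * n2 = s - 1" unfolding \<beta>_def using n2 by simp
    have "(\<beta> + \<beta> + \<beta> * \<beta> * n2) * n2 = c * n2"
      using \<beta>n2 ss by algebra
    then have SS: "S ** S = mat 1 + c *\<^sub>R outer b b"
      unfolding S_def identity_plus_outer_mult n2_def[symmetric] using n2 by simp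
    have "\<gamma> * (1 + \<beta> * n2) = \<beta>" unfolding \<beta>n2 \<gamma>_def using s1 by simp
    then have "\<beta> + - \<gamma> + \<beta> * - \<gamma> * n2 = 0" "- \<gamma> + \<beta> + - \<gamma> * \<beta> * n2 = 0"
      by (simp_all add: algebra_simps)
    then have "S ** (mat 1 + (- \<gamma>) *\<^sub>R outer b b) = mat 1" "(mat 1 + (- \<gamma>) *\<^sub>R outer b b) ** S = mat 1"
      unfolding S_def identity_plus_outer_mult n2_def by simp_all
    then have "invertible S" unfolding invertible_def by blast
    have St: "transpose S = S"
      unfolding S_def by (simp add: transpose_def vec_eq_iff outer_def mat_def mult.commute)
    have "transpose (S ** R) ** (S ** R) = transpose R ** (S ** S) ** R"
      by (simp add: matrix_transpose_mul St matrix_mul_assoc)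
    also have "\<dots> = transpose R ** R + c *\<^sub>R (transpose R ** outer b b ** R)"
      by (simp only: SS matrix_add_ldistrib matrix_add_rdistrib matrix_mul_rid matrix_scalar_ac
          flip: scalar_matrix_assoc)
    also have "transpose R ** outer b b ** R = outer a a"
      by (simp only: transpose_mult_outer_mult Rb)
    finally show ?thesis
      using invertible_mult[OF \<open>invertible S\<close> R] by (intro that)
  qed
qed

lemma gram_identity_plus_outer_sum:
  fixes a :: "nat \<Rightarrow> real^'n::finite" and c :: "nat \<Rightarrow> real"
  assumes "\<And>k. k < K \<Longrightarrow> c k \<ge> 0"
  obtains R :: "real^'n^'n"
  where "invertible R" "transpose R ** R = mat 1 + (\<Sum>k<K. c k *\<^sub>R outer (a k) (a k))"
  using assms
proof (induction K arbitrary: thesis)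
  case 0
  have "invertible (mat 1 :: real^'n^'n)" unfolding invertible_def by auto
  then show ?case using 0 by simp
next
  case (Suc K)
  obtain R :: "real^'n^'n"
    where R_inv: "invertible R" and R: "transpose R ** R = mat 1 + (\<Sum>k<K. c k *\<^sub>R outer (a k) (a k))"
    by (rule Suc.IH) (use Suc.prems(2) in auto)
  have "c K \<ge> 0" using Suc.prems(2) by simp
  then obtain R' :: "real^'n^'n"
    where "invertible R'" "transpose R' ** R' = transpose R ** R + c K *\<^sub>R outer (a K) (a K)"
    by (rule gram_add_outer[OF R_inv])
  then show ?case using Suc.prems(1) unfolding R by (simp add: add.assoc)
qed

section \<open>Bounds on the centred log-density\<close>

definition exp_excess :: "real \<Rightarrow> real" where
  "exp_excess x = exp x - 1 - x"

lemma exp_excess_bounds: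
  assumes "\<bar>x\<bar> \<le> 1"
  shows "x\<^sup>2 / (2 * exp 1) \<le> exp_excess x" "exp_excess x \<le> exp 1 / 2 * x\<^sup>2"
proof -
  obtain t where t: "\<bar>t\<bar> \<le> \<bar>x\<bar>" "exp x = (\<Sum>m<2. (x ^ m) / fact m) + (exp t / fact 2) * x ^ 2"
    using Maclaurin_exp_le[of x 2] by blast
  have eq: "exp_excess x = exp t / 2 * x\<^sup>2" using t(2) by (simp add: exp_excess_def numeral_2_eq_2)
  have "exp (-1) \<le> exp t" "exp t \<le> exp 1" using t(1) assms by auto
  then have lower: "1 / exp 1 \<le> exp t" and upper: "exp t \<le> exp 1"
    by (simp_all add: exp_minus field_simps)
  have "x\<^sup>2 / (2 * exp 1) = (1 / exp 1) / 2 * x\<^sup>2" by simp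
  also have "\<dots> \<le> exp_excess x"
    unfolding eq by (intro mult_right_mono divide_right_mono lower) auto
  finally show "x\<^sup>2 / (2 * exp 1) \<le> exp_excess x" .
  show "exp_excess x \<le> exp 1 / 2 * x\<^sup>2"
    unfolding eq by (intro mult_right_mono divide_right_mono upper) auto
qed

lemma exp_excess_mult_le:
  assumes "0 \<le> t" "t \<le> 1"
  shows "exp_excess (t * x) \<le> t * exp_excess x"
proof -
  have "exp ((1 - t) * 0 + t * x) \<le> (1 - t) * exp 0 + t * exp x"
    using convex_onD[OF exp_convex, of t 0 x] assms by simp
  then show ?thesis unfolding exp_excess_def by (simp add: algebra_simps)
qed

definition centred_logdens :: "nat \<Rightarrow> (nat \<Rightarrow> real^'n::finite) \<Rightarrow> (nat \<Rightarrow> real) \<Rightarrow> real^'n \<Rightarrow> real" where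
  "centred_logdens K a c \<theta> = - (\<Sum>k<K. c k * exp_excess (a k \<bullet> \<theta>)) - 1/2 * (\<theta> \<bullet> \<theta>)"

definition info_quad :: "nat \<Rightarrow> (nat \<Rightarrow> real^'n::finite) \<Rightarrow> (nat \<Rightarrow> real) \<Rightarrow> real^'n \<Rightarrow> real" where
  "info_quad K a c \<theta> = \<theta> \<bullet> \<theta> + (\<Sum>k<K. c k * (a k \<bullet> \<theta>)\<^sup>2)"

lemma centred_logdens_measurable[measurable]: "centred_logdens K a c \<in> borel_measurable borel"
  unfolding centred_logdens_def exp_excess_def by measurable

lemma info_quad_ge_inner:
  assumes "\<And>k. k < K \<Longrightarrow> c k \<ge> 0"
  shows "\<theta> \<bullet> \<theta> \<le> info_quad K a c \<theta>"
  unfolding info_quad_def using assms by (auto intro!: sum_nonneg)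

lemma info_quad_scaleR: "info_quad K a c (t *\<^sub>R \<theta>) = t\<^sup>2 * info_quad K a c \<theta>"
proof -
  have "(\<Sum>k<K. c k * (a k \<bullet> (t *\<^sub>R \<theta>))\<^sup>2) = t\<^sup>2 * (\<Sum>k<K. c k * (a k \<bullet> \<theta>)\<^sup>2)"
    by (simp add: sum_distrib_left power_mult_distrib mult_ac)
  then show ?thesis
    unfolding info_quad_def by (simp add: distrib_left power2_eq_square)
qed

lemma info_quad_nonneg:
  assumes "\<And>k. k < K \<Longrightarrow> c k \<ge> 0"
  shows "0 \<le> info_quad K a c \<theta>"
  unfolding info_quad_def using assms by (auto intro!: add_nonneg_nonneg sum_nonneg)

lemma norm_gram_mult:
  fixes R :: "real^'n::finite^'n"
  assumes "transpose R ** R = mat 1 + (\<Sum>k<K. c k *\<^sub>R outer (a k) (a k))"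
  shows "norm (R *v x) = sqrt (info_quad K a c x)"
proof -
  have "(R *v x) \<bullet> (R *v x) = x \<bullet> ((transpose R ** R) *v x)"
    by (metis dot_lmul_matrix matrix_vector_mul_assoc vector_transpose_matrix)
  also have "(transpose R ** R) *v x = x + (\<Sum>k<K. (c k * (a k \<bullet> x)) *\<^sub>R a k)"
    unfolding assms
    by (simp add: matrix_vector_mult_add_rdistrib matrix_vector_mult_sum matrix_vector_mult_outer
        flip: scaleR_matrix_vector_assoc)
  also have "x \<bullet> \<dots> = info_quad K a c x"
    unfolding info_quad_def by (simp add: inner_add_right inner_sum_right power2_eq_square inner_commute mult_ac)
  finally show ?thesis by (simp add: norm_eq_sqrt_inner)
qed

lemma abs_inner_le_one_if_info_quad_le:
  assumes c: "\<And>k. k < K \<Longrightarrow> c k \<ge> 0" and r: "\<And>k. k < K \<Longrightarrow> norm (a k) * r \<le> 1"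
    and q: "sqrt (info_quad K a c \<theta>) \<le> r" and k: "k < K"
  shows "\<bar>a k \<bullet> \<theta>\<bar> \<le> 1"
proof -
  have "\<theta> \<bullet> \<theta> \<le> info_quad K a c \<theta>"
    using c by (rule info_quad_ge_inner)
  then have "norm \<theta> \<le> sqrt (info_quad K a c \<theta>)"
    by (simp add: norm_eq_sqrt_inner)
  then have "norm (a k) * norm \<theta> \<le> norm (a k) * r" using q by (intro mult_left_mono) auto
  then show ?thesis using Cauchy_Schwarz_ineq2[of "a k" \<theta>] r[OF k] by linarith
qed

lemma centred_logdens_ge_ball:
  assumes c: "\<And>k. k < K \<Longrightarrow> c k \<ge> 0" and r: "\<And>k. k < K \<Longrightarrow> norm (a k) * r \<le> 1"
    and q: "sqrt (info_quad K a c \<theta>) \<le> r"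
  shows "- (exp 1 / 2) * r\<^sup>2 \<le> centred_logdens K a c \<theta>"
proof -
  have small: "\<bar>a k \<bullet> \<theta>\<bar> \<le> 1" if "k < K" for k
    using c r q that by (rule abs_inner_le_one_if_info_quad_le)
  have "c k * exp_excess (a k \<bullet> \<theta>) \<le> c k * (exp 1 / 2 * (a k \<bullet> \<theta>)\<^sup>2)" if "k < K" for k
    using exp_excess_bounds(2)[OF small[OF that]] c[OF that] by (rule mult_left_mono)
  then have "(\<Sum>k<K. c k * exp_excess (a k \<bullet> \<theta>)) \<le> (\<Sum>k<K. c k * (exp 1 / 2 * (a k \<bullet> \<theta>)\<^sup>2))"
    by (intro sum_mono) simp
  also have "\<dots> = exp 1 / 2 * (\<Sum>k<K. c k * (a k \<bullet> \<theta>)\<^sup>2)"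
    by (simp add: sum_distrib_left mult_ac)
  finally have "(\<Sum>k<K. c k * exp_excess (a k \<bullet> \<theta>)) \<le> \<dots>" .
  moreover have "1/2 * (\<theta> \<bullet> \<theta>) \<le> exp 1 / 2 * (\<theta> \<bullet> \<theta>)"
    using exp_ge_add_one_self[of 1] by (intro mult_right_mono) auto
  moreover have "info_quad K a c \<theta> \<le> r\<^sup>2"
    using q by (rule sqrt_le_D)
  then have "exp 1 / 2 * info_quad K a c \<theta> \<le> exp 1 / 2 * r\<^sup>2"
    by (intro mult_left_mono) auto
  moreover have "exp 1 / 2 * info_quad K a c \<theta>
      = exp 1 / 2 * (\<theta> \<bullet> \<theta>) + exp 1 / 2 * (\<Sum>k<K. c k * (a k \<bullet> \<theta>)\<^sup>2)"
    unfolding info_quad_def by (rule distrib_left)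
  ultimately show ?thesis
    unfolding centred_logdens_def by linarith
qed

lemma centred_logdens_le_ball:
  assumes c: "\<And>k. k < K \<Longrightarrow> c k \<ge> 0" and r: "\<And>k. k < K \<Longrightarrow> norm (a k) * r \<le> 1"
    and q: "sqrt (info_quad K a c \<theta>) \<le> r"
  shows "centred_logdens K a c \<theta> \<le> - info_quad K a c \<theta> / (2 * exp 1)"
proof -
  have small: "\<bar>a k \<bullet> \<theta>\<bar> \<le> 1" if "k < K" for k
    using c r q that by (rule abs_inner_le_one_if_info_quad_le)
  have "c k * ((a k \<bullet> \<theta>)\<^sup>2 / (2 * exp 1)) \<le> c k * exp_excess (a k \<bullet> \<theta>)" if "k < K" for k
    using exp_excess_bounds(1)[OF small[OF that]] c[OF that] by (rule mult_left_mono)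
  then have "(\<Sum>k<K. c k * ((a k \<bullet> \<theta>)\<^sup>2 / (2 * exp 1))) \<le> (\<Sum>k<K. c k * exp_excess (a k \<bullet> \<theta>))"
    by (intro sum_mono) simp
  then have "(\<Sum>k<K. c k * (a k \<bullet> \<theta>)\<^sup>2) / (2 * exp 1) \<le> (\<Sum>k<K. c k * exp_excess (a k \<bullet> \<theta>))"
    by (simp add: sum_divide_distrib)
  moreover have "(\<theta> \<bullet> \<theta>) / (2 * exp 1) = (1 / exp 1) * (1/2 * (\<theta> \<bullet> \<theta>))" by simp
  moreover have "(1 / exp 1) * (1/2 * (\<theta> \<bullet> \<theta>)) \<le> 1 * (1/2 * (\<theta> \<bullet> \<theta>))"
    using exp_ge_add_one_self[of 1] by (intro mult_right_mono) auto
  moreover have "- info_quad K a c \<theta> / (2 * exp 1)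
      = - ((\<theta> \<bullet> \<theta>) / (2 * exp 1)) - (\<Sum>k<K. c k * (a k \<bullet> \<theta>)\<^sup>2) / (2 * exp 1)"
    unfolding info_quad_def by (simp add: field_simps)
  ultimately show ?thesis
    unfolding centred_logdens_def by linarith
qed

lemma centred_logdens_scaleR_ge:
  assumes c: "\<And>k. k < K \<Longrightarrow> c k \<ge> 0" and t: "0 \<le> t" "t \<le> 1"
  shows "t * centred_logdens K a c \<theta> \<le> centred_logdens K a c (t *\<^sub>R \<theta>)"
proof -
  have "c k * exp_excess (t * (a k \<bullet> \<theta>)) \<le> c k * (t * exp_excess (a k \<bullet> \<theta>))" if "k < K" for k
    using exp_excess_mult_le[OF t] c[OF that] by (rule mult_left_mono)
  then have "(\<Sum>k<K. c k * exp_excess (a k \<bullet> (t *\<^sub>R \<theta>))) \<le> (\<Sum>k<K. c k * (t * exp_excess (a k \<bullet> \<theta>)))"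
    by (intro sum_mono) simp
  also have "\<dots> = t * (\<Sum>k<K. c k * exp_excess (a k \<bullet> \<theta>))"
    by (simp add: sum_distrib_left mult_ac)
  finally have "(\<Sum>k<K. c k * exp_excess (a k \<bullet> (t *\<^sub>R \<theta>))) \<le> \<dots>" .
  moreover have "(t * t) * (1/2 * (\<theta> \<bullet> \<theta>)) \<le> t * (1/2 * (\<theta> \<bullet> \<theta>))"
    using t by (intro mult_right_mono) (auto simp: mult_left_le)
  ultimately show ?thesis unfolding centred_logdens_def by (simp add: algebra_simps)
qed

text \<open>Outside the ball the quadratic bound is not available, but the concavity inequality
  \<open>centred_logdens_scaleR_ge\<close> transports the bound from the boundary sphere outwards,
  giving linear decay in \<open>\<surd>(info_quad)\<close>.\<close>

lemma centred_logdens_le: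
  assumes c: "\<And>k. k < K \<Longrightarrow> c k \<ge> 0" and "r > 0" and r: "\<And>k. k < K \<Longrightarrow> norm (a k) * r \<le> 1"
  shows "centred_logdens K a c \<theta> \<le> (r\<^sup>2 - r * sqrt (info_quad K a c \<theta>)) / (2 * exp 1)"
proof -
  define q where "q = sqrt (info_quad K a c \<theta>)"
  have qq: "q\<^sup>2 = info_quad K a c \<theta>"
    unfolding q_def using info_quad_nonneg[where c=c, OF c] by simp
  show ?thesis
  proof (cases "q \<le> r")
    case True
    have "r * q \<le> r * r" using True \<open>r > 0\<close> by simp
    then have "- q\<^sup>2 \<le> r\<^sup>2 - r * q"
      using zero_le_power2[of q] unfolding power2_eq_square by linarith
    then have "- info_quad K a c \<theta> / (2 * exp 1) \<le> (r\<^sup>2 - r * q) / (2 * exp 1)"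
      unfolding qq by (intro divide_right_mono) auto
    then show ?thesis
      using centred_logdens_le_ball[where c=c, OF c r True[unfolded q_def]] unfolding q_def by linarith
  next
    case False
    define t where "t = r / q"
    have t: "0 < t" "t \<le> 1" unfolding t_def using False \<open>r > 0\<close> by auto
    have boundary: "info_quad K a c (t *\<^sub>R \<theta>) = r\<^sup>2"
      unfolding info_quad_scaleR qq[symmetric] t_def using False \<open>r > 0\<close> by (simp add: power_divide)
    then have "sqrt (info_quad K a c (t *\<^sub>R \<theta>)) \<le> r"
      using \<open>r > 0\<close> by simp
    have "t * centred_logdens K a c \<theta> \<le> centred_logdens K a c (t *\<^sub>R \<theta>)"
      using c t by (intro centred_logdens_scaleR_ge) auto
    also have "\<dots> \<le> - info_quad K a c (t *\<^sub>R \<theta>) / (2 * exp 1)"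
      using c r \<open>sqrt (info_quad K a c (t *\<^sub>R \<theta>)) \<le> r\<close> by (rule centred_logdens_le_ball)
    finally have "t * centred_logdens K a c \<theta> \<le> - r\<^sup>2 / (2 * exp 1)"
      unfolding boundary .
    then have "centred_logdens K a c \<theta> \<le> - r\<^sup>2 / (2 * exp 1) / t"
      using t(1) by (simp add: field_simps)
    also have "\<dots> = - (r * q) / (2 * exp 1)"
      unfolding t_def using False \<open>r > 0\<close> by (simp add: field_simps power2_eq_square)
    also have "\<dots> \<le> (r\<^sup>2 - r * q) / (2 * exp 1)"
      by (intro divide_right_mono) auto
    finally show ?thesis unfolding q_def .
  qed
qed

section \<open>Bounds on the integral\<close>

lemma nn_integral_exp_neg_abs_finite:
  assumes "\<delta> > 0"
  shows "(\<integral>\<^sup>+x. ennreal (exp (- \<delta> * \<bar>x\<bar>)) \<partial>lborel) < \<infinity>"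
proof -
  define h where "h = (\<lambda>y::real. ennreal (y ^ 0 * exp (- y)) * indicator {0 ..} y)"
  have [measurable]: "h \<in> borel_measurable borel" unfolding h_def by measurable
  have h_integral: "(\<integral>\<^sup>+y. h y \<partial>lborel) = 1"
    unfolding h_def using nn_intergal_power_times_exp_Ici[of 0] by simp
  have finite: "(\<integral>\<^sup>+x. h (0 + s * x) \<partial>lborel) < \<infinity>" if "s \<noteq> 0" for s
  proof (rule ccontr)
    assume "\<not> (\<integral>\<^sup>+x. h (0 + s * x) \<partial>lborel) < \<infinity>"
    then have "ennreal \<bar>s\<bar> * (\<integral>\<^sup>+x. h (0 + s * x) \<partial>lborel) = \<infinity>"
      using that by (simp add: less_top[symmetric] ennreal_mult_eq_top_iff)
    then show False
      using nn_integral_real_affine[of h s 0] that h_integral by simp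
  qed
  have "ennreal (exp (- \<delta> * \<bar>x\<bar>)) \<le> h (0 + \<delta> * x) + h (0 + (- \<delta>) * x)" for x
  proof (cases "x \<ge> 0")
    case True
    then show ?thesis unfolding h_def using assms by simp
  next
    case False
    then have "\<delta> * x < 0" using assms by (simp add: mult_pos_neg)
    then show ?thesis unfolding h_def using False by (simp add: indicator_def)
  qed
  then have "(\<integral>\<^sup>+x. ennreal (exp (- \<delta> * \<bar>x\<bar>)) \<partial>lborel)
      \<le> (\<integral>\<^sup>+x. h (0 + \<delta> * x) + h (0 + (- \<delta>) * x) \<partial>lborel)"
    by (intro nn_integral_mono)
  also have "\<dots> = (\<integral>\<^sup>+x. h (0 + \<delta> * x) \<partial>lborel) + (\<integral>\<^sup>+x. h (0 + (- \<delta>) * x) \<partial>lborel)"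
    by (rule nn_integral_add) auto
  also have "\<dots> < \<infinity>" using finite[of \<delta>] finite[of "- \<delta>"] assms by simp
  finally show ?thesis .
qed

lemma nn_integral_exp_neg_norm_finite:
  assumes "\<gamma> > 0"
  shows "(\<integral>\<^sup>+u. ennreal (exp (- \<gamma> * norm (u::'a::euclidean_space))) \<partial>lborel) < \<infinity>"
proof -
  define \<delta> where "\<delta> = \<gamma> / DIM('a)"
  have "\<delta> > 0" unfolding \<delta>_def using assms by simp
  have "ennreal (exp (- \<gamma> * norm u)) \<le> (\<Prod>b\<in>Basis. ennreal (exp (- \<delta> * \<bar>u \<bullet> b\<bar>)))" for u :: 'a
  proof -
    have "(\<Sum>b\<in>Basis. \<bar>u \<bullet> b\<bar>) \<le> of_nat DIM('a) * norm u"
      by (rule sum_bounded_above) (rule Basis_le_norm)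
    then have "\<delta> * (\<Sum>b\<in>Basis. \<bar>u \<bullet> b\<bar>) \<le> \<delta> * (of_nat DIM('a) * norm u)"
      using \<open>\<delta> > 0\<close> by (intro mult_left_mono) auto
    also have "\<dots> = \<gamma> * norm u" unfolding \<delta>_def by simp
    finally have "exp (- \<gamma> * norm u) \<le> exp (\<Sum>b\<in>Basis. - \<delta> * \<bar>u \<bullet> b\<bar>)"
      by (simp add: sum_negf sum_distrib_left[symmetric])
    also have "\<dots> = (\<Prod>b\<in>Basis. exp (- \<delta> * \<bar>u \<bullet> b\<bar>))" by (rule exp_sum) simp
    finally show ?thesis by (simp add: prod_ennreal ennreal_leI)
  qed
  then have "(\<integral>\<^sup>+u. ennreal (exp (- \<gamma> * norm (u::'a))) \<partial>lborel)
      \<le> (\<integral>\<^sup>+u. (\<Prod>b\<in>Basis. ennreal (exp (- \<delta> * \<bar>(u::'a) \<bullet> b\<bar>))) \<partial>lborel)"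
    by (rule nn_integral_mono)
  also have "\<dots> = (\<Prod>b\<in>(Basis::'a set). (\<integral>\<^sup>+x. ennreal (exp (- \<delta> * \<bar>x\<bar>)) \<partial>lborel))"
    by (rule nn_integral_lborel_prod) auto
  also have "\<dots> < \<infinity>"
    using nn_integral_exp_neg_abs_finite[OF \<open>\<delta> > 0\<close>] by (simp add: power_less_top_ennreal)
  finally show ?thesis .
qed

lemma nn_integral_exp_centred_logdens_bounds:
  fixes a :: "nat \<Rightarrow> real^'n::finite" and R :: "real^'n^'n"
  assumes c: "\<And>k. k < K \<Longrightarrow> c k \<ge> 0" and "r > 0" and r: "\<And>k. k < K \<Longrightarrow> norm (a k) * r \<le> 1"
    and R: "invertible R" and gram: "transpose R ** R = mat 1 + (\<Sum>k<K. c k *\<^sub>R outer (a k) (a k))"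
  shows "ennreal (exp (- (exp 1 / 2) * r\<^sup>2) * measure lborel (ball (0::real^'n) r))
           \<le> ennreal \<bar>det R\<bar> * (\<integral>\<^sup>+\<theta>. exp (centred_logdens K a c \<theta>) \<partial>lborel)"
    and "ennreal \<bar>det R\<bar> * (\<integral>\<^sup>+\<theta>. exp (centred_logdens K a c \<theta>) \<partial>lborel)
           \<le> (\<integral>\<^sup>+u. exp ((r\<^sup>2 - r * norm (u::real^'n)) / (2 * exp 1)) \<partial>lborel)"
proof -
  have norm_R: "norm (R *v \<theta>) = sqrt (info_quad K a c \<theta>)" for \<theta>
    using gram by (rule norm_gram_mult)
  define CL where "CL = exp (- (exp 1 / 2) * r\<^sup>2)"
  have "emeasure lborel (ball (0::real^'n) r) = measure lborel (ball (0::real^'n) r)"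
    using emeasure_lborel_ball_finite[of "0::real^'n" r] by (intro emeasure_eq_ennreal_measure) simp
  then have "ennreal (CL * measure lborel (ball (0::real^'n) r))
      = (\<integral>\<^sup>+(u::real^'n). ennreal CL * indicator (ball 0 r) u \<partial>lborel)"
    unfolding CL_def by (simp add: ennreal_mult nn_integral_cmult_indicator)
  also have "\<dots> = ennreal \<bar>det R\<bar> * (\<integral>\<^sup>+\<theta>. ennreal CL * indicator (ball 0 r) (R *v \<theta>) \<partial>lborel)"
    using R by (rule nn_integral_matrix_substitution)
      (intro borel_measurable_times_ennreal borel_measurable_const borel_measurable_indicator, simp)
  also have "\<dots> \<le> ennreal \<bar>det R\<bar> * (\<integral>\<^sup>+\<theta>. exp (centred_logdens K a c \<theta>) \<partial>lborel)"
  proof (intro mult_left_mono nn_integral_mono)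
    fix \<theta>
    have "CL \<le> exp (centred_logdens K a c \<theta>)" if "R *v \<theta> \<in> ball 0 r"
    proof -
      have "sqrt (info_quad K a c \<theta>) \<le> r" using that norm_R[of \<theta>] by simp
      with c r have "- (exp 1 / 2) * r\<^sup>2 \<le> centred_logdens K a c \<theta>"
        by (rule centred_logdens_ge_ball)
      then show ?thesis unfolding CL_def by simp
    qed
    then show "ennreal CL * indicator (ball 0 r) (R *v \<theta>) \<le> ennreal (exp (centred_logdens K a c \<theta>))"
      by (simp add: indicator_def ennreal_leI)
  qed simp
  finally show "ennreal (exp (- (exp 1 / 2) * r\<^sup>2) * measure lborel (ball (0::real^'n) r))
      \<le> ennreal \<bar>det R\<bar> * (\<integral>\<^sup>+\<theta>. exp (centred_logdens K a c \<theta>) \<partial>lborel)"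
    unfolding CL_def .
  have "ennreal \<bar>det R\<bar> * (\<integral>\<^sup>+\<theta>. exp (centred_logdens K a c \<theta>) \<partial>lborel)
      \<le> ennreal \<bar>det R\<bar> * (\<integral>\<^sup>+\<theta>. exp ((r\<^sup>2 - r * norm (R *v \<theta>)) / (2 * exp 1)) \<partial>lborel)"
    using centred_logdens_le[OF c \<open>r > 0\<close> r] norm_R
    by (intro mult_left_mono nn_integral_mono) (simp_all add: ennreal_leI)
  also have "\<dots> = (\<integral>\<^sup>+u. exp ((r\<^sup>2 - r * norm (u::real^'n)) / (2 * exp 1)) \<partial>lborel)"
    using sym[OF nn_integral_matrix_substitution[OF R, where F="\<lambda>u. exp ((r\<^sup>2 - r * norm u) / (2 * exp 1))"]]
    by simp
  finally show "ennreal \<bar>det R\<bar> * (\<integral>\<^sup>+\<theta>. exp (centred_logdens K a c \<theta>) \<partial>lborel)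
      \<le> (\<integral>\<^sup>+u. exp ((r\<^sup>2 - r * norm (u::real^'n)) / (2 * exp 1)) \<partial>lborel)" .
qed

lemma det_mult_integral_exp_centred_logdens_bounds:
  fixes a :: "nat \<Rightarrow> real^'n::finite"
  obtains L U where "0 < L"
    and "\<And>c (R :: real^'n^'n). (\<And>k. k < K \<Longrightarrow> 0 \<le> c k) \<Longrightarrow> invertible R \<Longrightarrow>
           transpose R ** R = mat 1 + (\<Sum>k<K. c k *\<^sub>R outer (a k) (a k)) \<Longrightarrow>
           L \<le> \<bar>det R\<bar> * (LINT \<theta>|lborel. exp (centred_logdens K a c \<theta>)) \<and>
           \<bar>det R\<bar> * (LINT \<theta>|lborel. exp (centred_logdens K a c \<theta>)) \<le> U"
proof -
  define r where "r = 1 / (1 + (\<Sum>k<K. norm (a k)))"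
  have sum_ge: "norm (a k) \<le> (\<Sum>k<K. norm (a k))" if "k < K" for k
    using that by (intro member_le_sum) auto
  have "r > 0" unfolding r_def by (simp add: add_pos_nonneg sum_nonneg)
  have r: "norm (a k) * r \<le> 1" if "k < K" for k
    using sum_ge[OF that] unfolding r_def by (simp add: add_pos_nonneg sum_nonneg field_simps)
  define L where "L = exp (- (exp 1 / 2) * r\<^sup>2) * measure lborel (ball (0::real^'n) r)"
  define IU where "IU = (\<integral>\<^sup>+u. exp ((r\<^sup>2 - r * norm (u::real^'n)) / (2 * exp 1)) \<partial>lborel)"
  have "L > 0" unfolding L_def using \<open>r > 0\<close> by (simp add: content_ball_pos)
  have "IU = ennreal (exp (r\<^sup>2 / (2 * exp 1))) * (\<integral>\<^sup>+u. exp (- (r / (2 * exp 1)) * norm (u::real^'n)) \<partial>lborel)"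
    unfolding IU_def
    by (subst nn_integral_cmult[symmetric]) (simp_all add: ennreal_mult'[symmetric] diff_divide_distrib
        flip: exp_add)
  then have "IU < \<infinity>"
    using nn_integral_exp_neg_norm_finite[of "r / (2 * exp 1)", where 'a="real^'n"] \<open>r > 0\<close>
    by (simp add: ennreal_mult_less_top)
  show ?thesis
  proof (rule that[of L "enn2real IU"])
    fix c and R :: "real^'n^'n"
    assume c: "\<And>k. k < K \<Longrightarrow> 0 \<le> c k" and R: "invertible R"
      and gram: "transpose R ** R = mat 1 + (\<Sum>k<K. c k *\<^sub>R outer (a k) (a k))"
    define G where "G = (\<integral>\<^sup>+\<theta>. exp (centred_logdens K a c \<theta>) \<partial>lborel)"
    have bounds: "ennreal L \<le> ennreal \<bar>det R\<bar> * G" "ennreal \<bar>det R\<bar> * G \<le> IU"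
      unfolding L_def G_def IU_def
      using nn_integral_exp_centred_logdens_bounds[OF c \<open>r > 0\<close> r R gram] by simp_all
    have "\<bar>det R\<bar> * (LINT \<theta>|lborel. exp (centred_logdens K a c \<theta>)) = enn2real (ennreal \<bar>det R\<bar> * G)"
      unfolding G_def by (simp add: integral_eq_nn_integral enn2real_mult)
    moreover have "ennreal \<bar>det R\<bar> * G < \<infinity>"
      using bounds(2) \<open>IU < \<infinity>\<close> by (rule le_less_trans)
    then have "L \<le> enn2real (ennreal \<bar>det R\<bar> * G)"
      using enn2real_mono[OF bounds(1)] \<open>L > 0\<close> by simp
    moreover have "enn2real (ennreal \<bar>det R\<bar> * G) \<le> enn2real IU"
      using enn2real_mono[OF bounds(2)] \<open>IU < \<infinity>\<close> by simp
    ultimately show "L \<le> \<bar>det R\<bar> * (LINT \<theta>|lborel. exp (centred_logdens K a c \<theta>)) \<and>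
        \<bar>det R\<bar> * (LINT \<theta>|lborel. exp (centred_logdens K a c \<theta>)) \<le> enn2real IU"
      by simp
  qed (rule \<open>L > 0\<close>)
qed

section \<open>Recentring at the mode\<close>

lemma logdens_measurable[measurable]: "logdens K \<alpha> \<omega> \<eta> \<in> borel_measurable borel"
  unfolding logdens_def by measurable

text \<open>At the maximiser the derivative of \<open>f\<close> in the direction of the gradient
  \<open>w\<close> is \<open>|w|\<^sup>2\<close>, which must vanish.\<close>

lemma logdens_mode_eq:
  fixes \<alpha> :: "nat \<Rightarrow> real^'n::finite"
  assumes mode: "\<forall>\<theta>. logdens K \<alpha> \<omega> \<eta> \<theta> \<le> logdens K \<alpha> \<omega> \<eta> \<theta>h"
  shows "\<eta> = \<theta>h + (\<Sum>k<K. (\<omega> k * exp (\<alpha> k \<bullet> \<theta>h)) *\<^sub>R \<alpha> k)"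
proof -
  define w where "w = \<eta> - \<theta>h - (\<Sum>k<K. (\<omega> k * exp (\<alpha> k \<bullet> \<theta>h)) *\<^sub>R \<alpha> k)"
  define \<psi> where "\<psi> = (\<lambda>t::real. -(\<Sum>k<K. \<omega> k * exp (\<alpha> k \<bullet> \<theta>h + t * (\<alpha> k \<bullet> w)))
      + (\<eta> \<bullet> \<theta>h + t * (\<eta> \<bullet> w)) - 1/2 * (\<theta>h \<bullet> \<theta>h + 2 * t * (\<theta>h \<bullet> w) + t\<^sup>2 * (w \<bullet> w)))"
  have \<psi>: "logdens K \<alpha> \<omega> \<eta> (\<theta>h + t *\<^sub>R w) = \<psi> t" for t
    unfolding logdens_def \<psi>_def
    by (simp add: inner_add_right inner_add_left inner_commute power2_eq_square algebra_simps)
  define S where "S = (\<Sum>k<K. exp (\<alpha> k \<bullet> \<theta>h) * (\<alpha> k \<bullet> w) * \<omega> k)"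
  have deriv: "(\<psi> has_real_derivative (- S + \<eta> \<bullet> w - \<theta>h \<bullet> w)) (at 0)"
    unfolding \<psi>_def S_def by (rule derivative_eq_intros refl | simp)+
  have "\<forall>t. \<bar>0 - t\<bar> < 1 \<longrightarrow> \<psi> t \<le> \<psi> 0"
    using mode \<psi> by (metis add.right_neutral scaleR_zero_left)
  then have "- S + \<eta> \<bullet> w - \<theta>h \<bullet> w = 0"
    by (rule DERIV_local_max[OF deriv zero_less_one])
  moreover have "w \<bullet> w = \<eta> \<bullet> w - \<theta>h \<bullet> w - S"
    unfolding S_def by (subst (1) w_def) (simp add: inner_diff_left inner_sum_left mult_ac)
  ultimately have "w \<bullet> w = 0" by simp
  then have "w = 0" by simp
  then show ?thesis unfolding w_def by (simp add: algebra_simps)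
qed

lemma logdens_shift_mode:
  fixes \<alpha> :: "nat \<Rightarrow> real^'n::finite"
  assumes mode: "\<forall>\<theta>. logdens K \<alpha> \<omega> \<eta> \<theta> \<le> logdens K \<alpha> \<omega> \<eta> \<theta>h"
  shows "logdens K \<alpha> \<omega> \<eta> (\<theta>h + \<theta>)
           = logdens K \<alpha> \<omega> \<eta> \<theta>h + centred_logdens K \<alpha> (\<lambda>k. \<omega> k * exp (\<alpha> k \<bullet> \<theta>h)) \<theta>"
proof -
  define C where "C = (\<Sum>k<K. \<omega> k * exp (\<alpha> k \<bullet> \<theta>h))"
  define E where "E = (\<Sum>k<K. \<omega> k * exp (\<alpha> k \<bullet> \<theta>h) * exp (\<alpha> k \<bullet> \<theta>))"
  define L where "L = (\<Sum>k<K. \<omega> k * exp (\<alpha> k \<bullet> \<theta>h) * (\<alpha> k \<bullet> \<theta>))"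
  have "\<eta> \<bullet> \<theta> = \<theta>h \<bullet> \<theta> + L"
    unfolding L_def by (subst logdens_mode_eq[OF mode]) (simp add: inner_add_left inner_sum_left)
  moreover have "(\<Sum>k<K. \<omega> k * exp (\<alpha> k \<bullet> (\<theta>h + \<theta>))) = E"
    unfolding E_def by (simp add: inner_add_right exp_add mult.assoc)
  moreover have "(\<Sum>k<K. \<omega> k * exp (\<alpha> k \<bullet> \<theta>h) * exp_excess (\<alpha> k \<bullet> \<theta>)) = E - C - L"
    unfolding E_def C_def L_def exp_excess_def by (simp add: sum_subtractf right_diff_distrib)
  ultimately show ?thesis
    unfolding logdens_def centred_logdens_def C_def[symmetric]
    by (simp add: inner_add_right inner_add_left inner_commute algebra_simps)
qed

lemma integral_exp_logdens_shift_mode: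
  fixes \<alpha> :: "nat \<Rightarrow> real^'n::finite"
  assumes mode: "\<forall>\<theta>. logdens K \<alpha> \<omega> \<eta> \<theta> \<le> logdens K \<alpha> \<omega> \<eta> \<theta>h"
  shows "(LINT \<theta>|lborel. exp (logdens K \<alpha> \<omega> \<eta> \<theta>))
           = exp (logdens K \<alpha> \<omega> \<eta> \<theta>h)
             * (LINT \<theta>|lborel. exp (centred_logdens K \<alpha> (\<lambda>k. \<omega> k * exp (\<alpha> k \<bullet> \<theta>h)) \<theta>))"
proof -
  have "(LINT \<theta>|lborel. exp (logdens K \<alpha> \<omega> \<eta> \<theta>))
      = (LINT \<theta>|distr lborel borel ((+) \<theta>h). exp (logdens K \<alpha> \<omega> \<eta> \<theta>))"
    by (simp add: lborel_distr_plus)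
  also have "\<dots> = (LINT \<theta>|lborel. exp (logdens K \<alpha> \<omega> \<eta> (\<theta>h + \<theta>)))"
    by (simp add: integral_distr)
  finally show ?thesis
    by (simp add: logdens_shift_mode[OF mode] exp_add)
qed

lemma infomat_eq_gram:
  fixes \<alpha> :: "nat \<Rightarrow> real^'n::finite"
  assumes "\<And>k. k < K \<Longrightarrow> 0 \<le> \<omega> k"
  obtains R :: "real^'n^'n" where "invertible R" "transpose R ** R = infomat K \<alpha> \<omega> \<theta>"
proof -
  have "0 \<le> \<omega> k * exp (\<alpha> k \<bullet> \<theta>)" if "k < K" for k using assms[OF that] by simp
  then obtain R :: "real^'n^'n" where "invertible R"
    "transpose R ** R = mat 1 + (\<Sum>k<K. (\<omega> k * exp (\<alpha> k \<bullet> \<theta>)) *\<^sub>R outer (\<alpha> k) (\<alpha> k))"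
    by (rule gram_identity_plus_outer_sum)
  then show ?thesis by (intro that) (simp_all add: infomat_def)
qed

lemma det_infomat_pos:
  fixes \<alpha> :: "nat \<Rightarrow> real^'n::finite"
  assumes "\<And>k. k < K \<Longrightarrow> 0 \<le> \<omega> k"
  shows "0 < det (infomat K \<alpha> \<omega> \<theta>)"
proof -
  obtain R :: "real^'n^'n" where "invertible R" "transpose R ** R = infomat K \<alpha> \<omega> \<theta>"
    using assms by (rule infomat_eq_gram)
  then have "det (infomat K \<alpha> \<omega> \<theta>) = det R * det R" "det R \<noteq> 0"
    by (auto simp: det_mul det_transpose invertible_det_nz simp flip: \<open>transpose R ** R = _\<close>)
  then show ?thesis by (metis not_real_square_gt_zero)
qed

text \<open>The integral of \<open>e\<^sup>f\<close> divided by its Laplace approximation, up to the constant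
  factor \<open>(2\<pi>)\<^sup>d\<^sup>/\<^sup>2\<close>.\<close>

definition laplace_ratio :: "nat \<Rightarrow> (nat \<Rightarrow> real^'n::finite) \<Rightarrow> (nat \<Rightarrow> real) \<Rightarrow> real^'n \<Rightarrow> real^'n \<Rightarrow> real"
  where "laplace_ratio K \<alpha> \<omega> \<eta> \<theta>h =
    sqrt (det (infomat K \<alpha> \<omega> \<theta>h)) * (LINT \<theta>|lborel. exp (logdens K \<alpha> \<omega> \<eta> \<theta>)) / exp (logdens K \<alpha> \<omega> \<eta> \<theta>h)"

lemma laplace_ratio_bounds:
  fixes \<alpha> :: "nat \<Rightarrow> real^'n::finite"
  assumes \<omega>: "\<And>k. k < K \<Longrightarrow> 0 \<le> \<omega> k"
  obtains L U where "0 < L"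
    and "\<And>\<eta> \<theta>h. \<forall>\<theta>. logdens K \<alpha> \<omega> \<eta> \<theta> \<le> logdens K \<alpha> \<omega> \<eta> \<theta>h \<Longrightarrow>
           L \<le> laplace_ratio K \<alpha> \<omega> \<eta> \<theta>h \<and> laplace_ratio K \<alpha> \<omega> \<eta> \<theta>h \<le> U"
proof -
  obtain L U where "0 < L" and bounds: "\<And>c (R :: real^'n^'n). (\<And>k. k < K \<Longrightarrow> 0 \<le> c k) \<Longrightarrow>
      invertible R \<Longrightarrow> transpose R ** R = mat 1 + (\<Sum>k<K. c k *\<^sub>R outer (\<alpha> k) (\<alpha> k)) \<Longrightarrow>
      L \<le> \<bar>det R\<bar> * (LINT \<theta>|lborel. exp (centred_logdens K \<alpha> c \<theta>)) \<and>
      \<bar>det R\<bar> * (LINT \<theta>|lborel. exp (centred_logdens K \<alpha> c \<theta>)) \<le> U"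
    using det_mult_integral_exp_centred_logdens_bounds[where K=K and a=\<alpha>] by blast
  show ?thesis
  proof (rule that[OF \<open>0 < L\<close>])
    fix \<eta> \<theta>h :: "real^'n"
    assume mode: "\<forall>\<theta>. logdens K \<alpha> \<omega> \<eta> \<theta> \<le> logdens K \<alpha> \<omega> \<eta> \<theta>h"
    obtain R :: "real^'n^'n" where R: "invertible R" and gram: "transpose R ** R = infomat K \<alpha> \<omega> \<theta>h"
      using \<omega> by (rule infomat_eq_gram)
    have "0 \<le> \<omega> k * exp (\<alpha> k \<bullet> \<theta>h)" if "k < K" for k using \<omega>[OF that] by simp
    note bounds = bounds[OF this R gram[unfolded infomat_def]]
    have "laplace_ratio K \<alpha> \<omega> \<eta> \<theta>h
        = \<bar>det R\<bar> * (LINT \<theta>|lborel. exp (centred_logdens K \<alpha> (\<lambda>k. \<omega> k * exp (\<alpha> k \<bullet> \<theta>h)) \<theta>))"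
      unfolding laplace_ratio_def integral_exp_logdens_shift_mode[OF mode] gram[symmetric]
      by (simp add: det_mul det_transpose real_sqrt_mult_self)
    then show "L \<le> laplace_ratio K \<alpha> \<omega> \<eta> \<theta>h \<and> laplace_ratio K \<alpha> \<omega> \<eta> \<theta>h \<le> U"
      using bounds by simp
  qed
qed

lemma factor_bounds_of_ratio_bounds:
  fixes J x L U B :: real
  assumes "J = x * B" "0 < L" "L \<le> x" "x \<le> U" "0 < B"
  shows "B / max U (1 / L) \<le> J \<and> J \<le> max U (1 / L) * B"
proof
  have "B / max U (1 / L) \<le> B / (1 / L)"
    using assms by (intro divide_left_mono) auto
  also have "\<dots> \<le> J" using assms by simp
  finally show "B / max U (1 / L) \<le> J" .
  show "J \<le> max U (1 / L) * B"
    using assms by (simp add: mult_right_mono)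
qed

theorem proposition3:
  fixes K :: nat and \<alpha> :: "nat \<Rightarrow> real^'n" and \<omega> :: "nat \<Rightarrow> real"
  assumes "\<And>k. k < K \<Longrightarrow> \<omega> k > 0"
  shows "\<exists>M>0. \<forall>(\<eta>::real^'n) \<theta>h.
           (\<forall>\<theta>. logdens K \<alpha> \<omega> \<eta> \<theta> \<le> logdens K \<alpha> \<omega> \<eta> \<theta>h) \<longrightarrow>
           (let B = exp (logdens K \<alpha> \<omega> \<eta> \<theta>h) / sqrt (det (infomat K \<alpha> \<omega> \<theta>h));
                J = (LINT \<theta>|lborel. (2 * pi) powr (- real CARD('n) / 2) * exp (logdens K \<alpha> \<omega> \<eta> \<theta>))
            in B / M \<le> J \<and> J \<le> M * B)"
proof -
  have \<omega>: "\<And>k. k < K \<Longrightarrow> 0 \<le> \<omega> k" using assms less_imp_le by blast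
  define P where "P = (2 * pi) powr (- real CARD('n) / 2)"
  have "0 < P" unfolding P_def by simp
  have det: "0 < det (infomat K \<alpha> \<omega> \<theta>h)" for \<theta>h
    using \<omega> by (rule det_infomat_pos)
  have J: "(LINT \<theta>|lborel. (2 * pi) powr (- real CARD('n) / 2) * exp (logdens K \<alpha> \<omega> \<eta> \<theta>))
      = P * laplace_ratio K \<alpha> \<omega> \<eta> \<theta>h * (exp (logdens K \<alpha> \<omega> \<eta> \<theta>h) / sqrt (det (infomat K \<alpha> \<omega> \<theta>h)))"
    for \<eta> \<theta>h
    using det[of \<theta>h] by (simp add: laplace_ratio_def P_def)
  show ?thesis
  proof (rule laplace_ratio_bounds[where \<alpha>=\<alpha>, OF \<omega>])
    fix L U
    assume "0 < L" and bounds: "\<And>\<eta> \<theta>h. \<forall>\<theta>. logdens K \<alpha> \<omega> \<eta> \<theta> \<le> logdens K \<alpha> \<omega> \<eta> \<theta>h \<Longrightarrow>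
      L \<le> laplace_ratio K \<alpha> \<omega> \<eta> \<theta>h \<and> laplace_ratio K \<alpha> \<omega> \<eta> \<theta>h \<le> U"
    have ratio: "P * L \<le> P * laplace_ratio K \<alpha> \<omega> \<eta> \<theta>h \<and> P * laplace_ratio K \<alpha> \<omega> \<eta> \<theta>h \<le> P * U"
      if "\<forall>\<theta>. logdens K \<alpha> \<omega> \<eta> \<theta> \<le> logdens K \<alpha> \<omega> \<eta> \<theta>h" for \<eta> \<theta>h
      using bounds[OF that] \<open>0 < P\<close> by simp
    show ?thesis
      unfolding Let_def
      by (intro exI[of _ "max (P * U) (1 / (P * L))"] factor_bounds_of_ratio_bounds[OF J] conjI allI impI)
        (use ratio det \<open>0 < P\<close> \<open>0 < L\<close> in \<open>simp_all add: less_max_iff_disj\<close>)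
  qed
qed

end
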